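(* Let $\mathcal{A}$ be a union-closed family with universe $[n]$ and length $\ell$, let $C_1=[n]\supsetneq C_2\supsetneq\cdots\supsetneq C_{\ell+1}$ be a chain in $\mathcal{A}$ of maximum size, and define $\mathcal{C}_i$ and $\mathcal{D}_i$ for $i\in[\ell]$ as in the context. For any $i\in[\ell]$, if $C_{i+1}\neq\emptyset$, then $\mathcal{D}_i$ is union-closed.
   Context: A family is a finite family of distinct finite sets, at least one of which is nonempty; its universe is $U(\mathcal{A})=\bigcup_{A\in\mathcal{A}}A$. $\mathcal{A}$ is union-closed if $X_1,X_2\in\mathcal{A}$ implies $X_1\cup X_2\in\mathcal{A}$. A chain is a subfamily any two of whose members are comparable under inclusion; the length $\ell(\mathcal{A})$ is one less than the maximum size of a chain in $\mathcal{A}$. Note that $[n]\in\mathcal{A}$ and belongs to every maximum chain, so a maximum chain can be written $C_1=[n]\supsetneq C_2\supsetneq\cdots\supsetneq C_{\ell+1}$. With $[0]=\emptyset$, for each $i\in[\ell]$ define \[\mathcal{C}_i=\Big\{X\in\mathcal{A} : C_i\setminus C_{i+1}\subseteq X \text{ and } X\cap \textstyle\bigcup_{j\in[i-1]}(C_j\setminus C_{j+1})=\emptyset\Big\},\qquad \mathcal{D}_i=\{X\setminus (C_i\setminus C_{i+1}) : X\in\mathcal{C}_i\}.\] *)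

theory Defs
  imports Main
begin

definition is_family :: "'a set set \<Rightarrow> bool" where
  "is_family A \<longleftrightarrow> finite A \<and> (\<forall>X\<in>A. finite X) \<and> (\<exists>X\<in>A. X \<noteq> {})"

definition universe :: "'a set set \<Rightarrow> 'a set" where
  "universe A = \<Union>A"

text \<open>A union-closed family is in particular a family, so it has a nonempty member.\<close>

definition union_closed :: "'a set set \<Rightarrow> bool" where
  "union_closed A \<longleftrightarrow> is_family A \<and> (\<forall>X\<in>A. \<forall>Y\<in>A. X \<union> Y \<in> A)"

definition max_chain :: "'a set set \<Rightarrow> 'a set set \<Rightarrow> bool" where
  "max_chain A K \<longleftrightarrow> K \<in> chains A \<and> (\<forall>K'\<in>chains A. card K' \<le> card K)"

text \<open>For a family the maximum below is at least 1, so the subtraction does not truncate.\<close>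

definition family_length :: "'a set set \<Rightarrow> nat" where
  "family_length A = Max (card ` chains A) - 1"

definition C_family :: "'a set set \<Rightarrow> (nat \<Rightarrow> 'a set) \<Rightarrow> nat \<Rightarrow> 'a set set" where
  "C_family A C i =
     {X \<in> A. C i - C (i + 1) \<subseteq> X \<and> X \<inter> (\<Union>j\<in>{1..i - 1}. C j - C (j + 1)) = {}}"

definition D_family :: "'a set set \<Rightarrow> (nat \<Rightarrow> 'a set) \<Rightarrow> nat \<Rightarrow> 'a set set" where
  "D_family A C i = {X - (C i - C (i + 1)) | X. X \<in> C_family A C i}"

end

theory Submission
  imports Defs
begin

text \<open>Closure under unions is inherited from \<open>A\<close>: containing one fixed set and
  being disjoint from another are both preserved by unions, and deleting a fixed set distributes
  over unions. What remains is that \<open>D_family A C i\<close> is a family at all, above all that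
  it has a nonempty member. The chain supplies one: \<open>C i\<close> itself lies in
  \<open>C_family A C i\<close>, and deleting its top layer \<open>C i - C (i + 1)\<close> leaves
  \<open>C (i + 1)\<close>, which is nonempty by hypothesis.\<close>

lemma C_family_union_closed:
  assumes "\<forall>X\<in>A. \<forall>Y\<in>A. X \<union> Y \<in> A" "X \<in> C_family A C i" "Y \<in> C_family A C i"
  shows "X \<union> Y \<in> C_family A C i"
  using assms unfolding C_family_def by (simp add: Int_Un_distrib2 le_supI1)

text \<open>The same layer is deleted from every member, so the union of two preimages is a preimage
  of the union.\<close>

lemma D_family_union_closed:
  assumes "\<forall>X\<in>A. \<forall>Y\<in>A. X \<union> Y \<in> A" "P \<in> D_family A C i" "Q \<in> D_family A C i"
  shows "P \<union> Q \<in> D_family A C i"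
proof -
  let ?S = "C i - C (i + 1)"
  obtain X Y where XY: "X \<in> C_family A C i" "Y \<in> C_family A C i" "P = X - ?S" "Q = Y - ?S"
    using assms(2,3) unfolding D_family_def by auto
  have "P \<union> Q = (X \<union> Y) - ?S"
    using XY by blast
  then show ?thesis
    using C_family_union_closed[OF assms(1) XY(1,2)] unfolding D_family_def by auto
qed

text \<open>The layers above \<open>C i\<close> are discarded as the chain descends:
  \<open>C j - C (j + 1)\<close> misses \<open>C (j + 1)\<close>, hence misses the smaller set
  \<open>C i\<close>.\<close>

lemma chain_member_in_C_family:
  assumes "\<forall>j\<in>{1..<i}. C (j + 1) \<subseteq> C j" "C i \<in> A"
  shows "C i \<in> C_family A C i"
proof -
  have "C i \<subseteq> C (j + 1)" if "j \<in> {1..i - 1}" for j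
  proof -
    have "j + 1 \<le> i" using that by auto
    \<comment> \<open>Downward induction from \<open>i\<close> to \<open>j + 1\<close>, climbing the
      chain one inclusion at a time.\<close>
    then show ?thesis
    proof (induction rule: inc_induct)
      case (step m)
      then have "C (m + 1) \<subseteq> C m" using assms(1) by simp
      then show ?case using step.IH by simp
    qed simp
  qed
  then have "C i \<inter> (\<Union>j\<in>{1..i - 1}. C j - C (j + 1)) = {}"
    by fast
  then show ?thesis
    using assms(2) unfolding C_family_def by simp
qed

theorem theorem3p1:
  fixes A :: "nat set set" and C :: "nat \<Rightarrow> nat set" and n l i :: nat
  assumes "union_closed A"
    and "universe A = {1..n}"
    and "family_length A = l"
    and "C 1 = {1..n}"
    and "\<forall>j\<in>{1..l}. C (j + 1) \<subset> C j"
    and "max_chain A (C ` {1..l + 1})"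
    and "i \<in> {1..l}"
    and "C (i + 1) \<noteq> {}"
  shows "union_closed (D_family A C i)"
proof -
  let ?S = "C i - C (i + 1)"
  have A: "finite A" "\<forall>X\<in>A. finite X" "\<forall>X\<in>A. \<forall>Y\<in>A. X \<union> Y \<in> A"
    using assms(1) unfolding union_closed_def is_family_def by auto
  \<comment> \<open>As an image of a subfamily of \<open>A\<close>, the family inherits finiteness,
    and so do its members.\<close>
  have D_image: "D_family A C i = (\<lambda>X. X - ?S) ` C_family A C i"
    unfolding D_family_def by auto
  have C_sub: "C_family A C i \<subseteq> A"
    unfolding C_family_def by blast
  have "C ` {1..l + 1} \<subseteq> A"
    using assms(6) unfolding max_chain_def chains_def by blast
  then have "C i \<in> A"
    using assms(7) by auto
  moreover have "\<forall>j\<in>{1..<i}. C (j + 1) \<subseteq> C j"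
    using assms(5,7) by auto
  ultimately have "C i \<in> C_family A C i"
    by (intro chain_member_in_C_family)
  \<comment> \<open>Relative complement inside \<open>C i\<close> is an involution on subsets of
    \<open>C i\<close>; this yields the nonempty witness.\<close>
  moreover have "C i - ?S = C (i + 1)"
    using assms(5,7) by (intro double_diff) auto
  ultimately have "C (i + 1) \<in> D_family A C i"
    unfolding D_image by (metis imageI)
  moreover have "finite (D_family A C i)"
    using A(1) C_sub unfolding D_image by (auto intro: finite_subset)
  moreover have "\<forall>X\<in>D_family A C i. finite X"
    using A(2) C_sub unfolding D_image by auto
  ultimately have "is_family (D_family A C i)"
    using assms(8) unfolding is_family_def by blast
  then show ?thesis
    using D_family_union_closed[OF A(3)] unfolding union_closed_def by blast
qed

end
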